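(* For every odd integer $n\geq 3$ and every integer $d$ with $3\le d\le n$, there exists a symmetric diagonal Kotzig array of order $d\times n$.
   Context: For an integer $a$ and a positive integer $n$, $\langle a\rangle_n$ denotes the unique element of $\{1,\dots,n\}$ congruent to $a$ modulo $n$. For a $d\times n$ array $A=(a_{i,j})$ ($i\in\{1,\dots,d\}$, $j\in\{1,\dots,n\}$), the forward diagonals are, for each $j\in\{1,\dots,n\}$, the sets of entries $\{a_{i,\langle j+i\rangle_n}: i=1,\dots,d\}$. A $d\times n$ array $A=(a_{i,j})$ with $d\le n$ is a symmetric diagonal Kotzig array if: (1) each row is a permutation of $\{1,\dots,n\}$; (2) all columns have the same sum; (3) all forward diagonals have the same sum; (4) $a_{i,j}+a_{d+1-i,n+1-j}=n+1$ for all $i,j$. *)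

theory Defs
  imports "HOL-Number_Theory.Cong"
begin

definition residue_rep :: "int \<Rightarrow> nat \<Rightarrow> nat" where
  "residue_rep a n = (THE r. r \<in> {1..n} \<and> [int r = a] (mod int n))"

lemma residue_rep_unique:
  assumes "n > 0"
  shows "\<exists>!r. r \<in> {1..n} \<and> [int r = a] (mod int n)"
proof (rule ex1I)
  let ?r = "nat ((a - 1) mod int n) + 1"
  have b: "0 \<le> (a - 1) mod int n" "(a - 1) mod int n < int n"
    using assms by simp_all
  have "[(a - 1) mod int n + 1 = (a - 1) + 1] (mod int n)"
    by (rule cong_add) (simp_all add: cong_def)
  then have c: "[int ?r = a] (mod int n)"
    using b by (simp add: add.commute)
  show "?r \<in> {1..n} \<and> [int ?r = a] (mod int n)"
    using b c by auto
  fix r assume r: "r \<in> {1..n} \<and> [int r = a] (mod int n)"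
  then have "[int r - 1 = a - 1] (mod int n)"
    by (intro cong_diff) auto
  then have "int r - 1 = (a - 1) mod int n"
    using r by (simp add: cong_def)
  then have "?r = nat (int r - 1) + 1" by simp
  then show "r = ?r" using r by auto
qed

lemma residue_rep_eqI:
  assumes "r \<in> {1..n}" "[int r = a] (mod int n)"
  shows "residue_rep a n = r"
  unfolding residue_rep_def
  using assms by (intro the1_equality residue_rep_unique) auto

text \<open>
  A \<open>d \<times> n\<close> array is a function \<open>A\<close> of a row index in \<open>{1..d}\<close> and a column index
  in \<open>{1..n}\<close>; its values outside this range are irrelevant.  A forward diagonal is a family of
  \<open>d\<close> cells, one in each row, so its sum runs over the cells (values occurring repeatedly are
  counted repeatedly).  The common column sum and the common diagonal sum are not required to
  coincide a priori.
\<close>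

definition symmetric_diagonal_Kotzig_array :: "nat \<Rightarrow> nat \<Rightarrow> (nat \<Rightarrow> nat \<Rightarrow> nat) \<Rightarrow> bool" where
  "symmetric_diagonal_Kotzig_array d n A \<longleftrightarrow>
     d \<le> n \<and>
     (\<forall>i\<in>{1..d}. bij_betw (A i) {1..n} {1..n}) \<and>
     (\<exists>s. \<forall>j\<in>{1..n}. (\<Sum>i=1..d. A i j) = s) \<and>
     (\<exists>s. \<forall>j\<in>{1..n}. (\<Sum>i=1..d. A i (residue_rep (int j + int i) n)) = s) \<and>
     (\<forall>i\<in>{1..d}. \<forall>j\<in>{1..n}. A i j + A (d + 1 - i) (n + 1 - j) = n + 1)"

end

theory Submission
  imports Defs
begin

text \<open>
  Let \<open>n = 2m + 1\<close>, index columns by residues \<open>c\<close> with \<open>0\<close> the middle column, and let \<open>\<rho>\<close> be the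
  residue of least absolute value modulo \<open>n\<close>. All rows are taken of the form \<open>c \<mapsto> \<rho> (a c + b)\<close> with
  \<open>a\<close> a unit, and symmetry says that the opposite row has parameters \<open>(a, -b)\<close>. As \<open>\<rho>\<close> is odd,
  the four rows \<open>(1, p), (-1, -p), (-1, p), (1, -p)\<close>, two at the top and two at the bottom, cancel
  in every column; with \<open>p = (d - 2) / 2\<close> modulo \<open>n\<close> they also cancel on every diagonal. This leaves
  \<open>d = 3, 5, 6\<close>. For \<open>d = 3\<close> the duplication identity \<open>\<rho> z + \<rho> (z + 1/2) = \<rho> (2 z + 1/2)\<close> shows that
  \<open>(-1/2, -1/4), (1, 0), (-1/2, 1/4)\<close> works: passing from columns to diagonals only swaps the two
  outer rows. Stacking two copies gives \<open>d = 6\<close>, and the duplication identity applied twice gives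
  \<open>d = 5\<close> with \<open>(-1/4, -1/8), (-1/4, -3/8), (1, 0), (-1/4, 3/8), (-1/4, 1/8)\<close>.
\<close>

section \<open>Centred residues\<close>

text \<open>This is \<rho> for the modulus n = 2 m + 1.\<close>

definition centred_mod :: "nat \<Rightarrow> int \<Rightarrow> int" where
  "centred_mod m x = (x + int m) mod (2 * int m + 1) - int m"

lemma centred_mod_bounds: "- int m \<le> centred_mod m x" "centred_mod m x \<le> int m"
proof -
  have "0 \<le> (x + int m) mod (2 * int m + 1)" "(x + int m) mod (2 * int m + 1) < 2 * int m + 1"
    by (rule pos_mod_sign pos_mod_bound; simp)+
  then show "- int m \<le> centred_mod m x" "centred_mod m x \<le> int m"
    unfolding centred_mod_def by linarith+
qed

lemma cong_centred_mod: "[centred_mod m x = x] (mod 2 * int m + 1)"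
  unfolding centred_mod_def cong_def by (simp add: mod_diff_left_eq)

lemma centred_mod_eqI:
  assumes "[y = x] (mod 2 * int m + 1)" "- int m \<le> y" "y \<le> int m"
  shows "centred_mod m x = y"
proof -
  have "[x + int m = y + int m] (mod 2 * int m + 1)"
    using assms(1) by (simp add: cong_add_rcancel cong_sym)
  then have "(x + int m) mod (2 * int m + 1) = y + int m"
    using assms(2,3) by (simp add: cong_def)
  then show ?thesis by (simp add: centred_mod_def)
qed

lemma centred_mod_eq_iff: "centred_mod m x = centred_mod m y \<longleftrightarrow> [x = y] (mod 2 * int m + 1)"
  by (metis centred_mod_bounds centred_mod_eqI cong_centred_mod cong_sym cong_trans)

lemma centred_mod_minus: "centred_mod m (- x) = - centred_mod m x"
  by (rule centred_mod_eqI)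
    (use cong_centred_mod[of m x] centred_mod_bounds[where m = m and x = x] in
      \<open>simp_all add: cong_minus_minus_iff\<close>)

lemma centred_mod_shift: "x = y + (2 * int m + 1) * k \<Longrightarrow> centred_mod m x = centred_mod m y"
  by (simp add: centred_mod_eq_iff cong_iff_dvd_diff)

text \<open>The offset is 1/2 modulo n. Its representative \<open>s\<close> is m + 1 or -m according
  to the sign of \<open>y\<close>, so that \<open>y + s\<close> and \<open>2 * y + s\<close> both
  stay in [-m, m]; what remains is y + (y + s) = 2 y + s.\<close>

lemma centred_mod_double:
  "centred_mod m z + centred_mod m (z + (int m + 1)) = centred_mod m (2 * z + (int m + 1))"
proof -
  define y where "y = centred_mod m z"
  have y: "- int m \<le> y" "y \<le> int m" "[y = z] (mod 2 * int m + 1)"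
    unfolding y_def by (rule centred_mod_bounds cong_centred_mod)+
  define s where "s = (if y \<le> - 1 then int m + 1 else - int m)"
  have s: "[s = int m + 1] (mod 2 * int m + 1)"
    by (auto simp: s_def cong_iff_dvd_diff intro: dvdI[where k = "- 1"])
  have "centred_mod m (z + (int m + 1)) = y + s"
    by (intro centred_mod_eqI cong_add y s) (use y in \<open>auto simp: s_def\<close>)
  moreover have "centred_mod m (2 * z + (int m + 1)) = 2 * y + s"
    by (intro centred_mod_eqI cong_add cong_mult cong_refl y s) (use y in \<open>auto simp: s_def\<close>)
  ultimately show ?thesis by (simp add: y_def)
qed

text \<open>Since h * h is 1/4, the offsets are 0, 1/4, 1/2, 3/4. Doubling the two pairs at distance
  1/2 gives 2 z + 1/2 and 2 z + 1, again at distance 1/2.\<close>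

lemma centred_mod_quadruple:
  fixes m :: nat and z :: int
  defines "h \<equiv> int m + 1"
  shows "centred_mod m z + centred_mod m (z + h * h) + centred_mod m (z + 2 * h * h) +
    centred_mod m (z + 3 * h * h) = centred_mod m (4 * z + 3 * h)"
proof -
  have "centred_mod m z + centred_mod m (z + h) = centred_mod m (2 * z + h)"
    "centred_mod m (z + h * h) + centred_mod m (z + h * h + h)
      = centred_mod m (2 * (z + h * h) + h)"
    "centred_mod m (2 * z + h) + centred_mod m (2 * z + h + h) = centred_mod m (2 * (2 * z + h) + h)"
    unfolding h_def by (rule centred_mod_double)+
  moreover have "centred_mod m (z + 2 * h * h) = centred_mod m (z + h)"
    "centred_mod m (z + 3 * h * h) = centred_mod m (z + h * h + h)"
    "centred_mod m (2 * (z + h * h) + h) = centred_mod m (2 * z + h + h)"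
    by (rule centred_mod_shift[where k = h]; simp add: h_def algebra_simps)+
  ultimately show ?thesis by (simp add: algebra_simps)
qed

section \<open>Lists of affine rows\<close>

text \<open>
  The pair \<open>(a, b)\<close> stands for the row \<open>c \<mapsto> \<rho> (a c + b)\<close>. Slope \<open>s = 0\<close> gives the columns and
  \<open>s = 1\<close> the forward diagonals.
\<close>

fun line_sum :: "nat \<Rightarrow> int \<Rightarrow> int \<Rightarrow> (int \<times> int) list \<Rightarrow> int" where
  "line_sum m s c [] = 0"
| "line_sum m s c ((a, b) # L) = centred_mod m (a * c + b) + line_sum m s (c + s) L"

lemma line_sum_append:
  "line_sum m s c (L @ M) = line_sum m s c L + line_sum m s (c + s * int (length L)) M"
  by (induction L arbitrary: c rule: list.induct) (auto simp: algebra_simps)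

lemma line_sum_conv_sum:
  "line_sum m s c L =
    (\<Sum>i<length L. centred_mod m (fst (L ! i) * (c + s * int i) + snd (L ! i)))"
proof (induction L arbitrary: c)
  case (Cons p L)
  then show ?case
    by (cases p) (simp add: sum.lessThan_Suc_shift algebra_simps del: sum.lessThan_Suc)
qed simp

definition balanced_rows :: "nat \<Rightarrow> (int \<times> int) list \<Rightarrow> bool" where
  "balanced_rows m L \<longleftrightarrow>
    (\<forall>(a, b)\<in>set L. coprime a (2 * int m + 1)) \<and>
    (\<forall>c. line_sum m 0 c L = 0) \<and> (\<forall>c. line_sum m 1 c L = 0) \<and>
    rev (map (\<lambda>(a, b). (a, - b)) L) = L"

section \<open>Balanced lists of every length from 3 on\<close>

lemma coprime_half: "coprime (int m + 1) (2 * int m + 1)"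
proof (rule coprimeI)
  fix k assume "k dvd int m + 1" "k dvd 2 * int m + 1"
  then have "k dvd 2 * (int m + 1) - (2 * int m + 1)" by (intro dvd_diff dvd_mult)
  then show "is_unit k" by simp
qed

lemma balanced_rows_Nil: "balanced_rows m []"
  by (simp add: balanced_rows_def)

text \<open>On a diagonal the second copy starts further right, which is harmless because the sums
  vanish for every start \<open>c\<close>.\<close>

lemma balanced_rows_duplicate:
  "balanced_rows m L \<Longrightarrow> balanced_rows m (L @ L)"
  by (simp add: balanced_rows_def line_sum_append)

text \<open>In a column the two top rows cancel, and so do the two bottom rows. On a diagonal each
  top row cancels the bottom row \<open>length L + 2\<close> places below it, as 2 p is that
  distance modulo n.\<close>

lemma balanced_rows_wrap:
  assumes "balanced_rows m L"
  defines "p \<equiv> (int m + 1) * (int (length L) + 2)"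
  shows "balanced_rows m ([(1, p), (-1, - p)] @ L @ [(-1, p), (1, - p)])"
proof -
  have neg: "centred_mod m (- x - y) = - centred_mod m (x + y)"
    "centred_mod m (- x + y) = - centred_mod m (x - y)" for x y
    using centred_mod_minus[of m "x + y"] centred_mod_minus[of m "x - y"] by simp_all
  have shift: "centred_mod m (c + (2 + int (length L)) - p) = centred_mod m (c + p)" for c
    by (rule centred_mod_shift[where k = "- int (length L) - 2"]) (simp add: p_def algebra_simps)
  have "line_sum m 1 c ([(1, p), (-1, - p)] @ L @ [(-1, p), (1, - p)]) = 0" for c
    using assms(1) shift[of c] shift[of "c + 1"] neg[of "c + 1" p]
      neg[of "c + (2 + int (length L))" p]
    by (simp add: balanced_rows_def line_sum_append algebra_simps)
  moreover have "line_sum m 0 c ([(1, p), (-1, - p)] @ L @ [(-1, p), (1, - p)]) = 0" for c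
    using assms(1) neg[of c p] by (simp add: balanced_rows_def line_sum_append)
  ultimately show ?thesis
    using assms(1) unfolding balanced_rows_def by auto
qed

lemma balanced_rows_three:
  fixes m :: nat
  defines "h \<equiv> int m + 1"
  shows "balanced_rows m [(- h, - h * h), (1, 0), (- h, h * h)]"
proof -
  have col: "centred_mod m (- h * c - h * h) + centred_mod m c + centred_mod m (- h * c + h * h) = 0"
    for c
  proof -
    define z where "z = - h * c - h * h"
    have "centred_mod m z + centred_mod m (z + h) = centred_mod m (2 * z + h)"
      unfolding h_def by (rule centred_mod_double)
    moreover have "centred_mod m (- h * c + h * h) = centred_mod m (z + h)"
      by (rule centred_mod_shift[where k = h]) (simp add: z_def h_def algebra_simps)
    moreover have "centred_mod m (2 * z + h) = centred_mod m (- c)"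
      by (rule centred_mod_shift[where k = "- c - h"]) (simp add: z_def h_def algebra_simps)
    ultimately show ?thesis by (simp add: centred_mod_minus z_def)
  qed
  \<comment> \<open>Seen from the middle cell c + 1, one column to the left or right changes the
    outer argument by 1/2 or -1/2, which exchanges the offsets -1/4 and 1/4.\<close>
  have "centred_mod m (- h * c - h * h) = centred_mod m (- h * (c + 1) + h * h)"
    "centred_mod m (- h * (c + 1 + 1) + h * h) = centred_mod m (- h * (c + 1) - h * h)" for c
    by (rule centred_mod_shift[where k = "- h"] centred_mod_shift[where k = h];
        simp add: h_def algebra_simps)+
  then have "line_sum m 1 c [(- h, - h * h), (1, 0), (- h, h * h)] = 0" for c
    using col[of "c + 1"] by simp
  moreover have "line_sum m 0 c [(- h, - h * h), (1, 0), (- h, h * h)] = 0" for c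
    using col[of c] by simp
  ultimately show ?thesis
    using coprime_half[of m, folded h_def] by (simp add: balanced_rows_def)
qed

lemma balanced_rows_five:
  fixes m :: nat
  defines "h \<equiv> int m + 1"
  defines "w \<equiv> h * h" and "v \<equiv> h * h * h"
  shows "balanced_rows m [(- w, - v), (- w, - 3 * v), (1, 0), (- w, 3 * v), (- w, v)]"
proof -
  have col: "centred_mod m (- w * c - v) + centred_mod m (- w * c - 3 * v) + centred_mod m c +
    centred_mod m (- w * c + 3 * v) + centred_mod m (- w * c + v) = 0" for c
  proof -
    \<comment> \<open>As w = 1/4 and v = 1/8, the four outer offsets are those of z plus 0, 1/4,
      1/2, 3/4, and 4 z + 3/2 is -c.\<close>
    define z where "z = - w * c - 3 * v"
    have "centred_mod m z + centred_mod m (z + h * h) + centred_mod m (z + 2 * h * h) +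
      centred_mod m (z + 3 * h * h) = centred_mod m (4 * z + 3 * h)"
      unfolding h_def by (rule centred_mod_quadruple)
    moreover have "centred_mod m (- w * c - v) = centred_mod m (z + h * h)"
      by (rule centred_mod_shift[where k = w]) (simp add: z_def w_def v_def h_def algebra_simps)
    moreover have "centred_mod m (- w * c + v) = centred_mod m (z + 2 * h * h)"
      by (rule centred_mod_shift[where k = "2 * w"])
        (simp add: z_def w_def v_def h_def algebra_simps)
    moreover have "centred_mod m (- w * c + 3 * v) = centred_mod m (z + 3 * h * h)"
      by (rule centred_mod_shift[where k = "3 * w"])
        (simp add: z_def w_def v_def h_def algebra_simps)
    moreover have "centred_mod m (4 * z + 3 * h) = centred_mod m (- c)"
      by (rule centred_mod_shift[where k = "- c * (2 * h + 1) - 3 * h * (2 * h + 1)"])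
        (simp add: z_def w_def v_def h_def algebra_simps)
    ultimately show ?thesis by (simp add: centred_mod_minus z_def)
  qed
  have "line_sum m 1 c [(- w, - v), (- w, - 3 * v), (1, 0), (- w, 3 * v), (- w, v)] = 0" for c
  proof -
    \<comment> \<open>Relative to column c + 2 the outer rows gain 1/2, 1/4, -1/4, -1/2. The order
      of the rows is chosen so that this permutes their offsets.\<close>
    have "centred_mod m (- w * c - v) = centred_mod m (- w * (c + 2) + 3 * v)"
      by (rule centred_mod_shift[where k = "- 2 * w"]) (simp add: w_def v_def h_def algebra_simps)
    moreover have "centred_mod m (- w * (c + 1) - 3 * v) = centred_mod m (- w * (c + 2) - v)"
      by (rule centred_mod_shift[where k = "- w"]) (simp add: w_def v_def h_def algebra_simps)
    moreover have "centred_mod m (- w * (c + 3) + 3 * v) = centred_mod m (- w * (c + 2) + v)"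
      by (rule centred_mod_shift[where k = w]) (simp add: w_def v_def h_def algebra_simps)
    moreover have "centred_mod m (- w * (c + 4) + v) = centred_mod m (- w * (c + 2) - 3 * v)"
      by (rule centred_mod_shift[where k = "2 * w"]) (simp add: w_def v_def h_def algebra_simps)
    ultimately show ?thesis using col[of "c + 2"] by (simp add: add.assoc)
  qed
  moreover have "line_sum m 0 c [(- w, - v), (- w, - 3 * v), (1, 0), (- w, 3 * v), (- w, v)] = 0"
    for c
    using col[of c] by simp
  ultimately show ?thesis
    using coprime_half[of m, folded h_def] by (simp add: balanced_rows_def w_def)
qed

text \<open>Wrapping adds four rows, so the induction needs the lengths 3 to 6 as base cases; 4
  comes from wrapping the empty list.\<close>

lemma ex_balanced_rows:
  assumes "3 \<le> d"
  shows "\<exists>L. balanced_rows m L \<and> length L = d"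
  using assms
proof (induction d rule: less_induct)
  case (less d)
  have wrap: ?case if "balanced_rows m L" "d = length L + 4" for L
    using balanced_rows_wrap[OF that(1)] that(2)
    by (intro exI conjI) (assumption, simp)
  consider "d = 3" | "d = 4" | "d = 5" | "d = 6" | "7 \<le> d"
    using less.prems by linarith
  then show ?case
  proof cases
    case 1
    show ?thesis by (rule exI, rule conjI, rule balanced_rows_three) (simp add: 1)
  next
    case 2
    show ?thesis by (rule wrap[OF balanced_rows_Nil]) (simp add: 2)
  next
    case 3
    show ?thesis by (rule exI, rule conjI, rule balanced_rows_five) (simp add: 3)
  next
    case 4
    show ?thesis
      by (rule exI, rule conjI, rule balanced_rows_duplicate[OF balanced_rows_three]) (simp add: 4)
  next
    case 5
    then have "d - 4 < d" "3 \<le> d - 4" by simp_all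
    then obtain L where "balanced_rows m L" "length L = d - 4"
      using less.IH by blast
    with 5 show ?thesis using wrap[of L] by simp
  qed
qed

section \<open>The array of a list of rows\<close>

text \<open>Column j has coordinate c = j - m - 1, so reflecting columns negates c. Adding m + 1
  moves the entries to {1..n} and turns zero sums into d (m + 1).\<close>

lemma symmetric_diagonal_Kotzig_array_of_rows:
  fixes m d :: nat
  assumes "balanced_rows m L" and d: "d = length L" and "d \<le> 2 * m + 1"
  defines "B \<equiv> \<lambda>i j. centred_mod m (fst (L ! (i - 1)) * (int j - int m - 1) + snd (L ! (i - 1)))"
  shows "symmetric_diagonal_Kotzig_array d (2 * m + 1) (\<lambda>i j. nat (B i j + int m + 1))"
proof -
  let ?n = "2 * m + 1" and ?A = "\<lambda>i j. nat (B i j + int m + 1)"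
  have bounds: "- int m \<le> B i j" "B i j \<le> int m" for i j
    unfolding B_def by (rule centred_mod_bounds)+
  then have A: "int (?A i j) = B i j + int m + 1" for i j
    by (smt (verit) nat_0_le)
  \<comment> \<open>Columns (s = 0) and diagonals (s = 1) are treated together; \<open>f i\<close>
    is the column met in row i.\<close>
  have line: "(\<Sum>i=1..d. ?A i (f i)) = d * (m + 1)"
    if zero: "line_sum m s c L = 0"
      and f: "\<And>i. i \<in> {1..d} \<Longrightarrow> [int (f i) - int m - 1 = c + s * (int i - 1)]
        (mod 2 * int m + 1)"
    for s c f
  proof -
    have "(\<Sum>i=1..d. B i (f i)) = (\<Sum>i<d. B (Suc i) (f (Suc i)))"
      by (simp add: sum.atLeast1_atMost_eq)
    also have "\<dots> = line_sum m s c L"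
      unfolding line_sum_conv_sum d B_def
    proof (intro sum.cong refl)
      fix i assume "i \<in> {..<length L}"
      then show "centred_mod m (fst (L ! (Suc i - 1)) * (int (f (Suc i)) - int m - 1)
            + snd (L ! (Suc i - 1)))
          = centred_mod m (fst (L ! i) * (c + s * int i) + snd (L ! i))"
        using f[of "Suc i"] d
        by (auto simp: centred_mod_eq_iff intro!: cong_add cong_mult)
    qed
    finally have "int (\<Sum>i=1..d. ?A i (f i)) = int (d * (m + 1))"
      using zero by (simp only: int_sum A sum.distrib) (simp add: algebra_simps)
    then show ?thesis by (simp only: of_nat_eq_iff)
  qed
  have perm: "bij_betw (?A i) {1..?n} {1..?n}" if i: "i \<in> {1..d}" for i
  proof -
    obtain a b where ab: "L ! (i - 1) = (a, b)" by fastforce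
    moreover have "L ! (i - 1) \<in> set L" using i d by auto
    ultimately have coprime: "coprime a (2 * int m + 1)"
      using assms(1) by (auto simp: balanced_rows_def)
    have "inj_on (?A i) {1..?n}"
    proof (rule inj_onI)
      fix j k assume jk: "j \<in> {1..?n}" "k \<in> {1..?n}" and eq: "?A i j = ?A i k"
      have "B i j = B i k" using arg_cong[OF eq, of int] unfolding A by simp
      then have "[a * (int j - int m - 1) = a * (int k - int m - 1)] (mod 2 * int m + 1)"
        unfolding B_def ab centred_mod_eq_iff fst_conv snd_conv by (simp only: cong_add_rcancel)
      then have "[int j - int m - 1 = int k - int m - 1] (mod 2 * int m + 1)"
        using coprime by (simp add: cong_mult_lcancel)
      from cong_add[OF this cong_refl[of "int m"]]
      have "[int j - 1 = int k - 1] (mod 2 * int m + 1)"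
        by simp
      then show "j = k" using jk by (simp add: cong_def)
    qed
    moreover have "?A i ` {1..?n} \<subseteq> {1..?n}"
    proof (intro image_subsetI)
      fix j
      show "?A i j \<in> {1..?n}" using bounds[of i j] by auto
    qed
    ultimately show ?thesis
      unfolding bij_betw_def using endo_inj_surj[OF finite_atLeastAtMost] by blast
  qed
  have column: "(\<Sum>i=1..d. ?A i j) = d * (m + 1)" for j
    using assms(1) by (intro line[of 0 "int j - int m - 1"]) (simp_all add: balanced_rows_def)
  have diagonal: "(\<Sum>i=1..d. ?A i (residue_rep (int j + int i) ?n)) = d * (m + 1)" for j
  \<comment> \<open>Row 1 of the diagonal lies in column j + 1, whose coordinate is j - m.\<close>
  proof (rule line[of 1 "int j - int m"])
    fix i
    have "[int (residue_rep (int j + int i) ?n) = int j + int i] (mod 2 * int m + 1)"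
      using theI'[OF residue_rep_unique[of ?n "int j + int i"]]
      by (simp add: residue_rep_def add.commute)
    from cong_diff[OF this cong_refl[of "int m + 1"]]
    show "[int (residue_rep (int j + int i) ?n) - int m - 1
        = int j - int m + 1 * (int i - 1)] (mod 2 * int m + 1)"
      by (simp add: algebra_simps)
  qed (use assms(1) in \<open>simp add: balanced_rows_def\<close>)
  have symmetric: "?A i j + ?A (d + 1 - i) (?n + 1 - j) = ?n + 1"
    if ij: "i \<in> {1..d}" "j \<in> {1..?n}" for i j
  proof -
    obtain a b where ab: "L ! (i - 1) = (a, b)" by fastforce
    \<comment> \<open>Row d + 1 - i has list index d - i, the mirror image of index i - 1.\<close>
    have "d - i < length L" "length L - Suc (d - i) = i - 1" using ij d by auto
    then have "rev (map (\<lambda>(a, b). (a, - b)) L) ! (d - i) = (a, - b)"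
      using ab by (simp add: rev_nth)
    then have "L ! (d - i) = (a, - b)"
      using assms(1) by (simp add: balanced_rows_def)
    then have "B (d + 1 - i) (?n + 1 - j) = centred_mod m (- (a * (int j - int m - 1) + b))"
      using ij by (simp add: B_def of_nat_diff algebra_simps)
    also have "\<dots> = - B i j" by (simp only: centred_mod_minus B_def ab fst_conv snd_conv)
    finally have "int (?A i j) + int (?A (d + 1 - i) (?n + 1 - j)) = int (?n + 1)"
      unfolding A by simp
    then show ?thesis by (simp only: of_nat_add[symmetric] of_nat_eq_iff)
  qed
  show ?thesis
    unfolding symmetric_diagonal_Kotzig_array_def
    using assms(3) perm column diagonal symmetric by blast
qed

theorem theorem3p4:
  fixes n d :: nat
  assumes "odd n" and "n \<ge> 3" and "3 \<le> d" and "d \<le> n"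
  shows "\<exists>A. symmetric_diagonal_Kotzig_array d n A"
proof -
  from \<open>odd n\<close> obtain m where "n = 2 * m + 1" by (rule oddE)
  moreover obtain L where "balanced_rows m L" "length L = d"
    using ex_balanced_rows[OF \<open>3 \<le> d\<close>] by blast
  ultimately show ?thesis
    using symmetric_diagonal_Kotzig_array_of_rows[of m L d] \<open>d \<le> n\<close> by blast
qed

end
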